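(* If the quadrature $Q$ is exact or symmetric, then the scheme described in the context is symmetric (or time-reversible), i.e. for every $h\in\mathbb{R}\setminus\{0\}$ its one-step map satisfies $\bm{\Phi}_{h}\circ\bm{\Phi}_{-h}(\bm{Y})=\bm{Y}$ for all $\bm{Y}\in(\mathbb{R}^{dN})^3$.
   Context: Let $d,N\ge 1$ be integers, let $\bm{M}\in\mathbb{R}^{dN\times dN}$ be a symmetric positive definite (mass) matrix, and let $V\in C^2(\mathbb{R}^{dN};\mathbb{R})$ be the potential energy. Quadrature. For real $a,b$ and a continuous vector-valued function $f$, either $Q(f(t);a;b)=\int_a^b f(t)\,dt$ (exact quadrature) or $$Q(f(t);a;b) = (b-a)\sum_{i=0}^{I} \omega_i f(\lambda_i a + (1-\lambda_i)b),$$ with fixed real weights $\omega_0,\dots,\omega_I$ and fixed reals $\lambda_0,\dots,\lambda_I\in[0,1]$. The quadrature is called symmetric if $\omega_i = \omega_{I-i}$ and $\lambda_i = 1-\lambda_{I-i}$ for all $i\in\{0,\dots,I\}$. Scheme. With time nodes $t^n$ and $h_n=t^{n+1}-t^n>0$, the two-step scheme computes, from $\bm{p}^{n-1/2}$, $\bm{q}^n$, $\bm{p}^{n+1/2}\in\mathbb{R}^{dN}$, $$\bm{q}^{n+1} = \bm{q}^n + h_n \bm{M}^{-1}\bm{p}^{n+1/2},\qquad \frac{1}{2} \left(\bm{p}^{n+3/2} - \bm{p}^{n-1/2} \right) = -Q\left(\nabla V(\bm{\hat{q}}^n(t));t^n;t^{n+1}\right),$$ where $\bm{\hat{q}}^n(t)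 = \bm{q}^n + (t - t^n)\bm{M}^{-1}\bm{p}^{n+1/2}$. Setting $\bm{Y}^n = \left(\bm{q}^n,\ \tfrac12(\bm{p}^{n-1/2}+\bm{p}^{n+1/2}),\ \bm{p}^{n+1/2}-\bm{p}^{n-1/2}\right)$, the scheme reads $\bm{Y}^{n+1}=\bm{\Phi}_{h_n}(\bm{Y}^n)$, where, for positive and negative steps $h\neq0$ and $\bm{Y}=(\bm{Y}_1,\bm{Y}_2,\bm{Y}_3)\in(\mathbb{R}^{dN})^3$, with the abbreviation $\bm{W}=\bm{Y}_2+\frac{\operatorname{sign}(h)}{2}\bm{Y}_3$, $$\bm{\Phi}_{h}(\bm{Y}) = \left( \begin{array}{c} \bm{Y}_1 + h\bm{M}^{-1}\bm{W} \\ \bm{Y}_2 - Q\left(\nabla V\left(\bm{Y}_1+t\bm{M}^{-1}\bm{W}\right); 0 ; h\right) \\ -\bm{Y}_3 - 2\operatorname{sign}(h)\,Q\left(\nabla V\left(\bm{Y}_1+t\bm{M}^{-1}\bm{W}\right); 0 ; h\right) \end{array}\right).$$ *)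

theory Defs
  imports "HOL-Analysis.Analysis"
begin

text \<open>The space of positions (or momenta) of \<open>N\<close> particles in \<open>d\<close> dimensions is
  \<open>real ^ ('d \<times> 'N)\<close>, with coordinates indexed by pairs of a spatial direction and a particle.\<close>

definition symmetric_positive_definite :: "real ^ 'n ^ 'n \<Rightarrow> bool" where
  "symmetric_positive_definite M \<longleftrightarrow> transpose M = M \<and> (\<forall>x. x \<noteq> 0 \<longrightarrow> x \<bullet> (M *v x) > 0)"

definition gradient :: "('a::real_inner \<Rightarrow> real) \<Rightarrow> 'a \<Rightarrow> 'a" where
  "gradient V x = (THE D. GDERIV V x :> D)"

text \<open>In the definition of \<open>C\<^sup>2\<close>, \<open>H\<close> is the Hessian matrix.\<close>

definition C2 :: "(real ^ 'n \<Rightarrow> real) \<Rightarrow> bool" where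
  "C2 V \<longleftrightarrow> (\<forall>x. V differentiable at x) \<and>
     (\<exists>H :: real ^ 'n \<Rightarrow> real ^ 'n ^ 'n.
        (\<forall>x. (gradient V has_derivative (\<lambda>v. H x *v v)) (at x)) \<and> continuous_on UNIV H)"

text \<open>\<open>Weighted I \<omega> \<lambda>\<close> has the \<open>I + 1\<close> weights \<open>\<omega> i\<close> and nodes \<open>\<lambda> i\<close> with \<open>i \<le> I\<close>;
  the values of \<open>\<omega>\<close> and \<open>\<lambda>\<close> beyond \<open>I\<close> are irrelevant.\<close>

datatype quadrature =
    Exact
  | Weighted nat "nat \<Rightarrow> real" "nat \<Rightarrow> real"

fun valid_quadrature :: "quadrature \<Rightarrow> bool" where
  "valid_quadrature Exact \<longleftrightarrow> True"
| "valid_quadrature (Weighted I \<omega> l) \<longleftrightarrow> (\<forall>i\<le>I. l i \<in> {0..1})"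

fun exact_quadrature :: "quadrature \<Rightarrow> bool" where
  "exact_quadrature Exact \<longleftrightarrow> True"
| "exact_quadrature (Weighted I \<omega> l) \<longleftrightarrow> False"

text \<open>Symmetry is a property of weights and nodes, hence false by convention for exact
  quadrature.\<close>

fun symmetric_quadrature :: "quadrature \<Rightarrow> bool" where
  "symmetric_quadrature Exact \<longleftrightarrow> False"
| "symmetric_quadrature (Weighted I \<omega> l) \<longleftrightarrow> (\<forall>i\<le>I. \<omega> i = \<omega> (I - i) \<and> l i = 1 - l (I - i))"

text \<open>The interval integral is oriented: for \<open>b < a\<close> it is minus the integral from \<open>b\<close> to \<open>a\<close>.\<close>

fun quad :: "quadrature \<Rightarrow> (real \<Rightarrow> 'v::euclidean_space) \<Rightarrow> real \<Rightarrow> real \<Rightarrow> 'v" where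
  "quad Exact f a b = (LBINT t=a..b. f t)"
| "quad (Weighted I \<omega> l) f a b = (b - a) *\<^sub>R (\<Sum>i\<le>I. \<omega> i *\<^sub>R f (l i * a + (1 - l i) * b))"

definition one_step_map ::
  "quadrature \<Rightarrow> real ^ 'n ^ 'n \<Rightarrow> (real ^ 'n \<Rightarrow> real) \<Rightarrow> real \<Rightarrow>
     (real ^ 'n) \<times> (real ^ 'n) \<times> (real ^ 'n) \<Rightarrow> (real ^ 'n) \<times> (real ^ 'n) \<times> (real ^ 'n)" where
  "one_step_map Q M V h = (\<lambda>(Y1, Y2, Y3).
     let W = Y2 + (sgn h / 2) *\<^sub>R Y3;
         F = quad Q (\<lambda>t. gradient V (Y1 + t *\<^sub>R (matrix_inv M *v W))) 0 h
     in (Y1 + h *\<^sub>R (matrix_inv M *v W), Y2 - F, - Y3 - (2 * sgn h) *\<^sub>R F))"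

text \<open>The two-step scheme from time node \<open>t\<close> to \<open>t'\<close>. The arguments \<open>pm\<close>, \<open>q\<close>, \<open>p\<close> are the momentum
  half a step before \<open>t\<close>, the position at \<open>t\<close>, and the momentum half a step after \<open>t\<close>;
  \<open>q'\<close> and \<open>p'\<close> are the position at \<open>t'\<close> and the momentum half a step after \<open>t'\<close>.\<close>

definition two_step_scheme ::
  "quadrature \<Rightarrow> real ^ 'n ^ 'n \<Rightarrow> (real ^ 'n \<Rightarrow> real) \<Rightarrow> real \<Rightarrow> real \<Rightarrow>
     real ^ 'n \<Rightarrow> real ^ 'n \<Rightarrow> real ^ 'n \<Rightarrow> real ^ 'n \<Rightarrow> real ^ 'n \<Rightarrow> bool" where
  "two_step_scheme Q M V t t' pm q p q' p' \<longleftrightarrow>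
     q' = q + (t' - t) *\<^sub>R (matrix_inv M *v p) \<and>
     (1 / 2) *\<^sub>R (p' - pm) =
       - quad Q (\<lambda>s. gradient V (q + (s - t) *\<^sub>R (matrix_inv M *v p))) t t'"

lemma quad_shift:
  fixes f :: "real \<Rightarrow> 'v::euclidean_space"
  assumes "t < t'"
  shows "quad Q (\<lambda>s. f (s - t)) t t' = quad Q f 0 (t' - t)"
proof (cases Q)
  case Exact
  have "(LBINT s=t..t'. f (s - t)) = (\<integral>s. indicator {t<..<t'} s *\<^sub>R f (s - t) \<partial>lborel)"
    using assms by (simp add: interval_lebesgue_integral_def set_lebesgue_integral_def)
  also have "\<dots> = (\<integral>s. indicator {t<..<t'} (t + 1 * s) *\<^sub>R f (t + 1 * s - t) \<partial>lborel)"
    by (subst lborel_integral_real_affine[where c = 1 and t = t]) auto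
  also have "\<dots> = (\<integral>s. indicator {0<..<t' - t} s *\<^sub>R f s \<partial>lborel)"
    by (rule Bochner_Integration.integral_cong) (auto simp: indicator_def)
  also have "\<dots> = (LBINT s=0..t' - t. f s)"
    using assms
    by (simp add: interval_lebesgue_integral_def set_lebesgue_integral_def zero_ereal_def)
  finally show ?thesis using Exact by (simp add: zero_ereal_def)
next
  case (Weighted I \<omega> l)
  have "l i * t + (1 - l i) * t' - t = (1 - l i) * (t' - t)" for i
    by (simp add: algebra_simps)
  then show ?thesis using Weighted by simp
qed

lemma two_step_scheme_iff_one_step_map:
  assumes "t < t'"
  shows "two_step_scheme Q M V t t' pm q p q' p' \<longleftrightarrow>
    (q', (1 / 2) *\<^sub>R (p + p'), p' - p) =
      one_step_map Q M V (t' - t) (q, (1 / 2) *\<^sub>R (pm + p), p - pm)"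
proof -
  define F where "F = quad Q (\<lambda>s. gradient V (q + s *\<^sub>R (matrix_inv M *v p))) 0 (t' - t)"
  have W: "(1 / 2) *\<^sub>R (pm + p) + (1 / 2) *\<^sub>R (p - pm) = p"
    by (simp add: algebra_simps flip: scaleR_add_left)
  have eq: "quad Q (\<lambda>s. gradient V (q + (s - t) *\<^sub>R (matrix_inv M *v p))) t t' = F"
    using quad_shift[OF assms, of Q "\<lambda>s. gradient V (q + s *\<^sub>R (matrix_inv M *v p))"]
    by (simp add: F_def)
  have "(1 / 2) *\<^sub>R (p' - pm) = - F \<longleftrightarrow> (1 / 2) *\<^sub>R (p + p') = (1 / 2) *\<^sub>R (pm + p) - F"
    unfolding vec_eq_iff by (intro iff_allI) (simp add: field_simps, linarith?)
  moreover have "(1 / 2) *\<^sub>R (p' - pm) = - F \<longleftrightarrow> p' - p = - (p - pm) - 2 *\<^sub>R F"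
    unfolding vec_eq_iff by (intro iff_allI) (simp add: field_simps, linarith?)
  ultimately show ?thesis
    using assms W
    by (auto simp: two_step_scheme_def one_step_map_def Let_def eq simp flip: F_def)
qed

end

theory Submission
  imports Defs
begin

text \<open>
  The step of size \<open>-h\<close> moves the position from \<open>Y\<^sub>1\<close> to \<open>Y\<^sub>1 - h M\<^sup>-\<^sup>1 W\<close> along a straight line with
  momentum \<open>W = Y\<^sub>2 - (sgn h / 2) Y\<^sub>3\<close>. It turns \<open>Y\<^sub>2\<close> into \<open>Y\<^sub>2 - F\<close> and \<open>Y\<^sub>3\<close> into
  \<open>- Y\<^sub>3 + 2 (sgn h) F\<close>, where \<open>F\<close> is the force collected on the way. The following step of size
  \<open>h\<close> combines the two with the opposite sign, which the reflection of \<open>Y\<^sub>3\<close> undoes, and the two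
  contributions of \<open>F\<close> cancel because \<open>(sgn h)\<^sup>2 = 1\<close>: its momentum is again \<open>W\<close>. So it traverses
  the same segment backwards and the position returns to \<open>Y\<^sub>1\<close>.

  It remains to see that the force \<open>F'\<close> of the second step is \<open>-F\<close>, since then the changes of both
  momentum components cancel. Here \<open>F\<close> is the quadrature of some \<open>f\<close> from \<open>0\<close> to \<open>-h\<close>, and \<open>F'\<close> is
  that of \<open>f (t - h)\<close> from \<open>0\<close> to \<open>h\<close>. That these are opposite is the lemma \<open>quad_backwards\<close>, which
  rests on the quadrature being exact or symmetric.
\<close>

text \<open>Both sides come from the same nodes on the segment from \<open>-h\<close> to \<open>0\<close>: reversing the orientation
  of the interval exchanges the node \<open>i\<close> with the node \<open>I - i\<close>, which has the same weight.\<close>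

lemma weighted_quad_backwards:
  fixes f :: "real \<Rightarrow> 'v::euclidean_space"
  assumes "symmetric_quadrature (Weighted I \<omega> l)"
  shows "quad (Weighted I \<omega> l) (\<lambda>t. f (t - h)) 0 h = - quad (Weighted I \<omega> l) f 0 (- h)"
proof -
  have weight: "\<omega> (I - i) = \<omega> i" and node: "1 - l (I - i) = l i" if "i \<le> I" for i
  proof -
    have "\<omega> i = \<omega> (I - i)" and "l i = 1 - l (I - i)"
      using assms that unfolding symmetric_quadrature.simps by blast+
    then show "\<omega> (I - i) = \<omega> i" "1 - l (I - i) = l i" by (blast intro: sym)+
  qed
  have "(\<Sum>i\<le>I. \<omega> i *\<^sub>R f ((1 - l i) * (- h))) =
      (\<Sum>i\<le>I. \<omega> (I - i) *\<^sub>R f ((1 - l (I - i)) * (- h)))"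
    by (rule sum.reindex_bij_witness[where i = "\<lambda>i. I - i" and j = "\<lambda>i. I - i"]) auto
  also have "\<dots> = (\<Sum>i\<le>I. \<omega> i *\<^sub>R f ((1 - l i) * h - h))"
    by (intro sum.cong) (simp_all add: weight node algebra_simps)
  finally show ?thesis by simp
qed

text \<open>For \<open>h > 0\<close> this is translation invariance followed by reversing the orientation. The case
  \<open>h < 0\<close> is the case \<open>h > 0\<close> for the translated integrand, read from right to left.\<close>

lemma exact_quad_backwards:
  fixes f :: "real \<Rightarrow> 'v::euclidean_space"
  shows "quad Exact (\<lambda>t. f (t - h)) 0 h = - quad Exact f 0 (- h)"
proof -
  have pos: "quad Exact (\<lambda>t. g (t - k)) 0 k = - quad Exact g 0 (- k)"
    if "k > 0" for k and g :: "real \<Rightarrow> 'v"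
  proof -
    have "quad Exact (\<lambda>t. g (t - k)) 0 k = quad Exact g (- k) 0"
      using quad_shift[of "- k" 0 Exact "\<lambda>t. g (t - k)"] that by simp
    also have "\<dots> = - quad Exact g 0 (- k)"
      unfolding quad.simps by (rule interval_integral_endpoints_reverse)
    finally show ?thesis .
  qed
  consider "h > 0" | "h = 0" | "h < 0" by linarith
  then show ?thesis
  proof cases
    case 1
    then show ?thesis by (rule pos)
  next
    case 2
    then show ?thesis by simp
  next
    case 3
    then show ?thesis using pos[of "- h" "\<lambda>t. f (t - h)"] by simp
  qed
qed

lemma quad_backwards:
  fixes f :: "real \<Rightarrow> 'v::euclidean_space"
  assumes "exact_quadrature Q \<or> symmetric_quadrature Q"
  shows "quad Q (\<lambda>t. f (t - h)) 0 h = - quad Q f 0 (- h)"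
proof (cases Q)
  case Exact
  then show ?thesis using exact_quad_backwards by blast
next
  case (Weighted I \<omega> l)
  then have "\<not> exact_quadrature Q" by simp
  with assms have "symmetric_quadrature (Weighted I \<omega> l)" unfolding Weighted by blast
  then show ?thesis unfolding Weighted by (rule weighted_quad_backwards)
qed

theorem proposition4:
  fixes M :: "real ^ ('d::finite \<times> 'N::finite) ^ ('d \<times> 'N)"
    and V :: "real ^ ('d \<times> 'N) \<Rightarrow> real"
    and Q :: quadrature
  assumes "symmetric_positive_definite M"
    and "C2 V"
    and "valid_quadrature Q"
    and "exact_quadrature Q \<or> symmetric_quadrature Q"
  shows "\<forall>h. h \<noteq> 0 \<longrightarrow> (\<forall>Y. (one_step_map Q M V h \<circ> one_step_map Q M V (- h)) Y = Y)"
proof (intro allI impI)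
  fix h :: real and Y :: "(real ^ ('d \<times> 'N)) \<times> (real ^ ('d \<times> 'N)) \<times> (real ^ ('d \<times> 'N))"
  assume "h \<noteq> 0"
  obtain Y1 Y2 Y3 where Y: "Y = (Y1, Y2, Y3)" by (cases Y)
  define s where "s = sgn h"
  have s: "s * s = 1" using \<open>h \<noteq> 0\<close> by (simp add: s_def sgn_if)
  define W where "W = Y2 - (s / 2) *\<^sub>R Y3"
  define v where "v = matrix_inv M *v W"
  define f where "f = (\<lambda>t. gradient V (Y1 + t *\<^sub>R v))"
  define F where "F = quad Q f 0 (- h)"
  have backward_step: "one_step_map Q M V (- h) Y = (Y1 - h *\<^sub>R v, Y2 - F, - Y3 + (2 * s) *\<^sub>R F)"
    by (simp add: Y one_step_map_def Let_def sgn_minus F_def f_def v_def W_def s_def)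
  have same_momentum: "(Y2 - F) + (s / 2) *\<^sub>R (- Y3 + (2 * s) *\<^sub>R F) = W"
    using s by (simp add: W_def algebra_simps)
  have "(\<lambda>t. gradient V ((Y1 - h *\<^sub>R v) + t *\<^sub>R v)) = (\<lambda>t. f (t - h))"
    by (simp add: f_def algebra_simps)
  then have opposite_force: "quad Q (\<lambda>t. gradient V ((Y1 - h *\<^sub>R v) + t *\<^sub>R v)) 0 h = - F"
    using quad_backwards[OF assms(4), of f h] by (simp add: F_def)
  have "one_step_map Q M V h (Y1 - h *\<^sub>R v, Y2 - F, - Y3 + (2 * s) *\<^sub>R F) = Y"
    unfolding one_step_map_def Let_def prod.case s_def[symmetric] same_momentum
      v_def[symmetric] opposite_force
    by (simp add: Y)
  then show "(one_step_map Q M V h \<circ> one_step_map Q M V (- h)) Y = Y"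
    by (simp add: backward_step)
qed

end
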